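(* Let $X$ be a finitely supported random vector in $\mathbb R^d$ with mean $\mu=\mathbb E X$, let $M$ be a symmetric positive definite $d\times d$ matrix, and let $u\in\mathbb R^d$, $u\ne0$. With the notation of the context, for $1\le i\le m$, $$V_i-V_{i-1}=p_i(L_i^2-R_i^2)=-p_iH_i .$$ Consequently, the polygon joining the points $(P_i,V_i)$, $0\le i\le m$ (with $P_0=0$), is convex if and only if $$H_1\ge H_2\ge\cdots\ge H_m .$$ A sufficient, but stronger, condition is that $(L_i^2)_{1\le i\le m}$ is nondecreasing and $(R_i^2)_{1\le i\le m}$ is nonincreasing.
   Context: Write $\langle x,y\rangle_M:=x^{\mathsf T}My$ and $\|x\|_M^2:=\langle x,x\rangle_M$. Order the distinct values of $Y:=u^{\mathsf T}(X-\mu)$ as $t_1<\cdots<t_m$. Put $p_i:=\mathbb P(Y=t_i)$, $z_i:=\mathbb E[X-\mu\mid Y=t_i]$, $P_i:=\sum_{j\le i}p_j$, $q_i:=1-P_i$, and $$a_i:=\frac1{P_i}\sum_{j\le i}p_jz_j\ (1\le i\le m),\qquad b_i:=\frac1{q_i}\sum_{j>i}p_jz_j\ (0\le i\le m-1).$$ For $1\le i\le m-1$, $V_i$ is the least quadratic risk obtained from the partition $\{Y\le t_i\}\mid\{Y>t_i\}$, i.e. the minimum over $\alpha,\beta\in\mathbb R^d$ of $\mathbb E[\|X-\alpha\|_M^2\mathbf 1_{\{Y\le t_i\}}+\|X-\beta\|_M^2\mathbf 1_{\{Y>t_i\}}]$. Also $V_0=V_m:=\mathbb E\|X-\mu\|_M^2$.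 The vector radii are $L_1^2:=0$, $R_m^2:=0$, $$L_i^2:=\langle z_i-a_{i-1},z_i-a_i\rangle_M=\frac{P_{i-1}}{P_i}\|z_i-a_{i-1}\|_M^2\quad(2\le i\le m),$$ $$R_i^2:=\langle b_{i-1}-z_i,b_i-z_i\rangle_M=\frac{q_i}{q_{i-1}}\|b_i-z_i\|_M^2\quad(1\le i\le m-1),$$ and the signal is $H_i:=R_i^2-L_i^2$, $1\le i\le m$. *)

theory Defs
  imports "HOL-Probability.Probability"
begin

definition spd :: "real^'d^'d \<Rightarrow> bool" where
  "spd M \<longleftrightarrow> transpose M = M \<and> (\<forall>x. x \<noteq> 0 \<longrightarrow> x \<bullet> (M *v x) > 0)"

definition inner_M :: "real^'d^'d \<Rightarrow> real^'d \<Rightarrow> real^'d \<Rightarrow> real" where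
  "inner_M M x y = x \<bullet> (M *v y)"

definition sqnorm_M :: "real^'d^'d \<Rightarrow> real^'d \<Rightarrow> real" where
  "sqnorm_M M x = inner_M M x x"

definition finitely_supported :: "'a measure \<Rightarrow> ('a \<Rightarrow> real^'d) \<Rightarrow> bool" where
  "finitely_supported N X \<longleftrightarrow>
     X \<in> borel_measurable N \<and> (\<exists>S. finite S \<and> (AE \<omega> in N. X \<omega> \<in> S))"

text \<open>The polygonal line through the points \<open>(x i, y i)\<close>, \<open>0 \<le> i \<le> n\<close>, as a subset of the plane.
  It is called convex if it is the graph of a convex function on \<open>[x 0, x n]\<close>
  (not: if it is a convex set).\<close>

definition polygon :: "(nat \<Rightarrow> real) \<Rightarrow> (nat \<Rightarrow> real) \<Rightarrow> nat \<Rightarrow> (real \<times> real) set" where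
  "polygon x y n = (\<Union>i\<in>{1..n}. closed_segment (x (i - 1), y (i - 1)) (x i, y i))"

definition convex_polygon :: "(nat \<Rightarrow> real) \<Rightarrow> (nat \<Rightarrow> real) \<Rightarrow> nat \<Rightarrow> bool" where
  "convex_polygon x y n \<longleftrightarrow>
     (\<exists>f. convex_on {x 0..x n} f \<and> polygon x y n = (\<lambda>s. (s, f s)) ` {x 0..x n})"

lemma scaleR_left_cancel_div:
  fixes x y :: "'b::real_vector"
  assumes "c *\<^sub>R x = d *\<^sub>R y" "c \<noteq> 0"
  shows "x = (d / c) *\<^sub>R y"
proof -
  have "x = (1 / c) *\<^sub>R (c *\<^sub>R x)" using assms(2) by simp
  also have "\<dots> = (d / c) *\<^sub>R y" unfolding assms(1) by simp
  finally show ?thesis .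
qed

text \<open>The locale only fixes the data of the problem (probability space, random vector, matrix,
  direction); it makes no assumptions.\<close>

locale split =
  fixes N :: "'a measure" and X :: "'a \<Rightarrow> real^'d" and M :: "real^'d^'d" and u :: "real^'d"
begin

definition mu :: "real^'d" where
  "mu = (\<integral>\<omega>. X \<omega> \<partial>N)"

definition Y :: "'a \<Rightarrow> real" where
  "Y \<omega> = u \<bullet> (X \<omega> - mu)"

text \<open>The distinct values of \<open>Y\<close> are those taken with positive probability: on a null set \<open>X\<close>, and
  hence \<open>Y\<close>, may take arbitrary further values.\<close>

definition vals :: "real set" where
  "vals = {s. measure N {\<omega> \<in> space N. Y \<omega> = s} > 0}"

definition m :: nat where
  "m = card vals"

definition t :: "nat \<Rightarrow> real" where
  "t i = sorted_list_of_set vals ! (i - 1)"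

definition p :: "nat \<Rightarrow> real" where
  "p i = measure N {\<omega> \<in> space N. Y \<omega> = t i}"

definition z :: "nat \<Rightarrow> real^'d" where
  "z i = (1 / p i) *\<^sub>R (\<integral>\<omega>. indicator {\<omega>. Y \<omega> = t i} \<omega> *\<^sub>R (X \<omega> - mu) \<partial>N)"

definition P :: "nat \<Rightarrow> real" where
  "P i = (\<Sum>j=1..i. p j)"

definition q :: "nat \<Rightarrow> real" where
  "q i = 1 - P i"

definition a :: "nat \<Rightarrow> real^'d" where
  "a i = (1 / P i) *\<^sub>R (\<Sum>j=1..i. p j *\<^sub>R z j)"

definition b :: "nat \<Rightarrow> real^'d" where
  "b i = (1 / q i) *\<^sub>R (\<Sum>j=i+1..m. p j *\<^sub>R z j)"

definition risk :: "nat \<Rightarrow> real^'d \<Rightarrow> real^'d \<Rightarrow> real" where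
  "risk i \<alpha> \<beta> = (\<integral>\<omega>. sqnorm_M M (X \<omega> - \<alpha>) * indicator {\<omega>. Y \<omega> \<le> t i} \<omega>
                    + sqnorm_M M (X \<omega> - \<beta>) * indicator {\<omega>. Y \<omega> > t i} \<omega> \<partial>N)"

text \<open>\<open>LEAST\<close> is the minimum, so an evaluation of \<open>V i\<close> has to show that it is attained.\<close>

definition V :: "nat \<Rightarrow> real" where
  "V i = (if i = 0 \<or> i = m then (\<integral>\<omega>. sqnorm_M M (X \<omega> - mu) \<partial>N)
          else (LEAST v. \<exists>\<alpha> \<beta>. v = risk i \<alpha> \<beta>))"

definition L_sq :: "nat \<Rightarrow> real" where
  "L_sq i = (if i = 1 then 0 else inner_M M (z i - a (i - 1)) (z i - a i))"

definition R_sq :: "nat \<Rightarrow> real" where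
  "R_sq i = (if i = m then 0 else inner_M M (b (i - 1) - z i) (b i - z i))"

definition H :: "nat \<Rightarrow> real" where
  "H i = R_sq i - L_sq i"

lemma L_sq_eq:
  assumes "2 \<le> i" "P (i - 1) \<noteq> 0" "P i \<noteq> 0"
  shows "L_sq i = P (i - 1) / P i * sqnorm_M M (z i - a (i - 1))"
proof -
  obtain k where i: "i = Suc k" using assms(1) by (cases i) auto
  have Pi: "P (Suc k) = P k + p (Suc k)" by (simp add: P_def)
  have "P (Suc k) *\<^sub>R a (Suc k) = P k *\<^sub>R a k + p (Suc k) *\<^sub>R z (Suc k)"
    using assms(2,3) unfolding a_def i by simp
  then have "P (Suc k) *\<^sub>R (z (Suc k) - a (Suc k)) = P k *\<^sub>R (z (Suc k) - a k)"
    by (simp add: Pi algebra_simps)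
  then have "z i - a i = (P k / P i) *\<^sub>R (z i - a k)"
    using assms(3) scaleR_left_cancel_div unfolding i by blast
  then show ?thesis
    using assms(1) by (simp add: L_sq_def sqnorm_M_def inner_M_def i matrix_vector_mult_scaleR)
qed

lemma R_sq_eq:
  assumes "1 \<le> i" "i < m" "q (i - 1) \<noteq> 0" "q i \<noteq> 0"
  shows "R_sq i = q i / q (i - 1) * sqnorm_M M (b i - z i)"
proof -
  obtain k where i: "i = Suc k" using assms(1) by (cases i) auto
  have qk: "q k = q (Suc k) + p (Suc k)" by (simp add: q_def P_def)
  have "(\<Sum>j=Suc k..m. p j *\<^sub>R z j) = p (Suc k) *\<^sub>R z (Suc k) + (\<Sum>j=Suc (Suc k)..m. p j *\<^sub>R z j)"
    using assms(2) unfolding i by (subst sum.atLeast_Suc_atMost) auto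
  then have "q k *\<^sub>R b k = p (Suc k) *\<^sub>R z (Suc k) + q (Suc k) *\<^sub>R b (Suc k)"
    using assms(3,4) unfolding b_def i by simp
  then have "q k *\<^sub>R (b k - z (Suc k)) = q (Suc k) *\<^sub>R (b (Suc k) - z (Suc k))"
    by (simp add: qk algebra_simps)
  then have "b k - z i = (q i / q k) *\<^sub>R (b i - z i)"
    using assms(3) scaleR_left_cancel_div unfolding i by simp
  then show ?thesis
    using assms(2) by (simp add: R_sq_def sqnorm_M_def inner_M_def i)
qed

end

end

theory Submission
  imports Defs
begin

text \<open>With \<open>S i = (\<Sum>j\<le>i. p j *\<^sub>R z j)\<close>, completing squares in the two centres gives
  \<open>V i = E\<parallel>X - mu\<parallel>\<^sup>2 - \<parallel>S i\<parallel>\<^sup>2 / P i - \<parallel>S i\<parallel>\<^sup>2 / q i\<close>. The increments of the last two terms are the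
  within-group variances gained or lost when the atom \<open>z i\<close> is moved from the right group, with sum
  \<open>- S i\<close>, to the left group, with sum \<open>S i\<close>; these are \<open>p i * L_sq i\<close> and \<open>p i * R_sq i\<close>. Hence
  \<open>- H i\<close> is the slope of the \<open>i\<close>-th edge, and the polygon is convex iff its slopes increase.\<close>

section \<open>Convexity of a polygonal line in terms of its slopes\<close>

lemma closed_segment_graph:
  fixes a b c d :: real
  assumes "a < b"
  shows "closed_segment (a, c) (b, d) = (\<lambda>s. (s, c + (d - c) / (b - a) * (s - a))) ` {a..b}"
proof -
  have "closed_segment (a, c) (b, d) = (\<lambda>r. (a + r * (b - a), c + r * (d - c))) ` {0..1}"
    by (auto simp: closed_segment_def image_iff algebra_simps)
  \<comment> \<open>Since \<open>a < b\<close>, the first coordinate itself can serve as the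
    parameter of the segment.\<close>
  also have "\<dots> = (\<lambda>s. (s, c + (d - c) / (b - a) * (s - a))) ` ((\<lambda>r. a + r * (b - a)) ` {0..1})"
    using assms by (auto simp: image_image intro!: image_cong)
  also have "(\<lambda>r. a + r * (b - a)) ` {0..1} = {a..b}"
    using assms closed_segment_real_eq[of a b]
    by (simp add: closed_segment_eq_real_ivl mult.commute add.commute)
  finally show ?thesis .
qed

text \<open>Each \<open>f i\<close> at an intermediate point is bounded by the combination of its
  own end values, hence of the two maxima. This serves for the upper envelope of the edge
  lines.\<close>

lemma convex_on_Max:
  fixes f :: "'i \<Rightarrow> 'b::real_vector \<Rightarrow> real"
  assumes "finite I" "I \<noteq> {}" "convex S" "\<And>i. i \<in> I \<Longrightarrow> convex_on S (f i)"
  shows "convex_on S (\<lambda>s. Max ((\<lambda>i. f i s) ` I))"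
proof (rule convex_onI)
  fix r x y assume r: "0 < r" "r < (1::real)" and xy: "x \<in> S" "y \<in> S"
  have "f i ((1 - r) *\<^sub>R x + r *\<^sub>R y)
      \<le> (1 - r) * Max ((\<lambda>i. f i x) ` I) + r * Max ((\<lambda>i. f i y) ` I)" if "i \<in> I" for i
  proof -
    have "f i ((1 - r) *\<^sub>R x + r *\<^sub>R y) \<le> (1 - r) * f i x + r * f i y"
      using assms(4)[OF that] r xy by (auto simp: convex_on_def)
    also have "\<dots> \<le> (1 - r) * Max ((\<lambda>i. f i x) ` I) + r * Max ((\<lambda>i. f i y) ` I)"
      using r that assms(1) by (intro add_mono mult_left_mono Max_ge) auto
    finally show ?thesis .
  qed
  then show "Max ((\<lambda>i. f i ((1 - r) *\<^sub>R x + r *\<^sub>R y)) ` I)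
      \<le> (1 - r) * Max ((\<lambda>i. f i x) ` I) + r * Max ((\<lambda>i. f i y) ` I)"
    using assms(1,2) by (auto intro!: Max.boundedI)
qed (fact assms(3))

lemma strict_steps_mono:
  fixes x :: "nat \<Rightarrow> real"
  assumes "\<And>i. i \<in> {1..n} \<Longrightarrow> x (i - 1) < x i" "i \<le> j" "j \<le> n"
  shows "x i \<le> x j"
  using assms(2,3)
proof (induction j rule: dec_induct)
  case (step k)
  then show ?case using assms(1)[of "Suc k"] by simp
qed simp

lemma ex_step_containing:
  fixes x :: "nat \<Rightarrow> real"
  assumes "1 \<le> n" "x 0 \<le> s" "s \<le> x n"
  obtains i where "i \<in> {1..n}" "x (i - 1) \<le> s" "s \<le> x i"
proof -
  \<comment> \<open>The first vertex from index 1 on that is not left of \<open>s\<close>. Its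
    predecessor is left of \<open>s\<close> by minimality, or is \<open>x 0\<close> when
    \<open>k = 1\<close>.\<close>
  define k where "k = (LEAST k. 1 \<le> k \<and> s \<le> x k)"
  have k: "1 \<le> k" "s \<le> x k" and kn: "k \<le> n"
    using LeastI[of "\<lambda>k. 1 \<le> k \<and> s \<le> x k" n] Least_le[of "\<lambda>k. 1 \<le> k \<and> s \<le> x k" n] assms
    by (auto simp: k_def)
  have "x (k - 1) \<le> s"
  proof (cases "k = 1")
    case False
    then show ?thesis
      using not_less_Least[of "k - 1" "\<lambda>k. 1 \<le> k \<and> s \<le> x k"] k unfolding k_def[symmetric]
      by auto
  qed (use assms in simp)
  then show ?thesis using that k kn by auto
qed

text \<open>If the slopes increase, the polygon is the upper envelope of the lines through its edges.\<close>

lemma convex_polygon_iff: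
  fixes x y \<sigma> :: "nat \<Rightarrow> real"
  assumes n: "1 \<le> n"
    and x: "\<And>i. i \<in> {1..n} \<Longrightarrow> x (i - 1) < x i"
    and \<sigma>: "\<And>i. i \<in> {1..n} \<Longrightarrow> y i - y (i - 1) = \<sigma> i * (x i - x (i - 1))"
  shows "convex_polygon x y n \<longleftrightarrow> mono_on {1..n} \<sigma>"
proof
  assume "convex_polygon x y n"
  then obtain f where f: "convex_on {x 0..x n} f"
    and graph: "polygon x y n = (\<lambda>s. (s, f s)) ` {x 0..x n}"
    by (auto simp: convex_polygon_def)
  \<comment> \<open>Vertices belong to the polygon, hence to the graph, so the unknown
    \<open>f\<close> is determined at them.\<close>
  have vertex: "f (x i) = y i" if "i \<le> n" for i
  proof -
    have "(x i, y i) \<in> polygon x y n"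
    proof (cases i)
      case 0
      then show ?thesis using n by (auto simp: polygon_def intro!: bexI[of _ 1])
    next
      case (Suc k)
      then show ?thesis using that by (auto simp: polygon_def intro!: bexI[of _ i])
    qed
    then show ?thesis by (auto simp: graph)
  qed
  have slope_step: "\<sigma> i \<le> \<sigma> (Suc i)" if i: "1 \<le> i" "i < n" for i
  proof -
    have less: "x (i - 1) < x i" "x i < x (Suc i)" using x[of i] x[of "Suc i"] i by auto
    have "x 0 \<le> x (i - 1)" "x (Suc i) \<le> x n"
      using i strict_steps_mono[of n x 0 "i - 1"] strict_steps_mono[of n x "Suc i" n] x by auto
    then have in_dom: "x (i - 1) \<in> {x 0..x n}" "x (Suc i) \<in> {x 0..x n}" using less by auto
    \<comment> \<open>The three-chord inequality at three consecutive vertices; its two quotients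
      are the slopes of adjacent edges.\<close>
    have "(f (x (i - 1)) - f (x i)) / (x (i - 1) - x i)
        \<le> (f (x i) - f (x (Suc i))) / (x i - x (Suc i))"
      using convex_on_slope_le[OF f in_dom] less by fastforce
    moreover have "(f (x (i - 1)) - f (x i)) / (x (i - 1) - x i) = \<sigma> i"
      using \<sigma>[of i] i less by (simp add: vertex divide_eq_eq algebra_simps)
    moreover have "(f (x i) - f (x (Suc i))) / (x i - x (Suc i)) = \<sigma> (Suc i)"
      using \<sigma>[of "Suc i"] i less by (simp add: vertex divide_eq_eq algebra_simps)
    ultimately show ?thesis by simp
  qed
  show "mono_on {1..n} \<sigma>"
  proof (rule mono_onI)
    fix i j assume "i \<in> {1..n}" "j \<in> {1..n}" "i \<le> j"
    then have "1 \<le> i" "j \<le> n" by auto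
    from \<open>i \<le> j\<close> \<open>j \<le> n\<close> show "\<sigma> i \<le> \<sigma> j"
    proof (induction j rule: dec_induct)
      case (step k)
      then show ?case using \<open>1 \<le> i\<close> slope_step[of k] by simp
    qed simp
  qed
next
  assume mono: "mono_on {1..n} \<sigma>"
  define l where "l i s = y (i - 1) + \<sigma> i * (s - x (i - 1))" for i s
  define f where "f s = Max ((\<lambda>i. l i s) ` {1..n})" for s
  \<comment> \<open>The lines through adjacent edges meet at the vertex \<open>x k\<close>, so with
    increasing slopes their order changes only there.\<close>
  have diff: "l (Suc k) s - l k s = (\<sigma> (Suc k) - \<sigma> k) * (s - x k)" if "1 \<le> k" "k < n" for k s
    using \<sigma>[of k] that by (simp add: l_def algebra_simps)
  have incr: "\<sigma> k \<le> \<sigma> (Suc k)" if "1 \<le> k" "k < n" for k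
    using that by (intro mono_onD[OF mono]) auto
  have x_mono: "x i \<le> x j" if "i \<le> j" "j \<le> n" for i j
    using strict_steps_mono[of n x i j] x that by blast
  \<comment> \<open>From the left end of edge \<open>j\<close> on, its line dominates all earlier
    ones; \<open>left\<close> is the mirror image. Over its own edge a line therefore attains the
    maximum \<open>f\<close>.\<close>
  have right: "l i s \<le> l j s" if "i \<le> j" "1 \<le> i" "j \<le> n" "x (j - 1) \<le> s" for i j s
    using that(1,3,4)
  proof (induction j rule: dec_induct)
    case (step k)
    have "x (k - 1) \<le> s" using x_mono[of "k - 1" k] step.prems by simp
    moreover have "0 \<le> (\<sigma> (Suc k) - \<sigma> k) * (s - x k)"
      using step.prems step.hyps that(2) incr[of k] by (intro mult_nonneg_nonneg) auto
    ultimately show ?case using step diff[of k s] that(2) by simp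
  qed simp
  have left: "l j s \<le> l i s" if "i \<le> j" "1 \<le> i" "j \<le> n" "s \<le> x i" for i j s
    using that(1,3)
  proof (induction j rule: dec_induct)
    case (step k)
    have "s \<le> x k" using x_mono[of i k] step that(4) by simp
    then have "(\<sigma> (Suc k) - \<sigma> k) * (s - x k) \<le> 0"
      using step.prems step.hyps that(2) incr[of k] by (intro mult_nonneg_nonpos) auto
    then show ?case using step diff[of k s] that(2) by simp
  qed simp
  have f_eq: "f s = l i s" if i: "i \<in> {1..n}" and s: "x (i - 1) \<le> s" "s \<le> x i" for i s
    unfolding f_def
  proof (rule Max_eqI)
    fix v assume "v \<in> (\<lambda>i. l i s) ` {1..n}"
    then obtain j where "j \<in> {1..n}" "v = l j s" by auto
    then show "v \<le> l i s" using left[of i j s] right[of j i s] i s by (cases "i \<le> j") auto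
  qed (use i in auto)
  have "convex_on {x 0..x n} f"
    unfolding f_def
  proof (rule convex_on_Max)
    show "convex_on {x 0..x n} (l i)" for i
      by (rule convex_onI) (auto simp: l_def algebra_simps)
  qed (use n in auto)
  moreover have edge: "closed_segment (x (i - 1), y (i - 1)) (x i, y i)
      = (\<lambda>s. (s, f s)) ` {x (i - 1)..x i}" if "i \<in> {1..n}" for i
    using closed_segment_graph[OF x[OF that]] \<sigma>[OF that] x[OF that] f_eq[OF that]
    by (auto simp: l_def)
  have "polygon x y n = (\<lambda>s. (s, f s)) ` (\<Union>i\<in>{1..n}. {x (i - 1)..x i})"
    unfolding polygon_def image_UN using edge by simp
  moreover have "(\<Union>i\<in>{1..n}. {x (i - 1)..x i}) = {x 0..x n}"
  proof
    show "(\<Union>i\<in>{1..n}. {x (i - 1)..x i}) \<subseteq> {x 0..x n}"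
    proof
      fix s assume "s \<in> (\<Union>i\<in>{1..n}. {x (i - 1)..x i})"
      then obtain i where "i \<in> {1..n}" "x (i - 1) \<le> s" "s \<le> x i" by auto
      moreover from this have "x 0 \<le> x (i - 1)" "x i \<le> x n" by (auto intro!: x_mono)
      ultimately show "s \<in> {x 0..x n}" by auto
    qed
    show "{x 0..x n} \<subseteq> (\<Union>i\<in>{1..n}. {x (i - 1)..x i})"
    proof
      fix s assume "s \<in> {x 0..x n}"
      then show "s \<in> (\<Union>i\<in>{1..n}. {x (i - 1)..x i})"
        using ex_step_containing[OF n, of x s] by (metis UN_iff atLeastAtMost_iff)
    qed
  qed
  ultimately show "convex_polygon x y n" by (auto simp: convex_polygon_def)
qed

section \<open>The bilinear form defined by \<open>M\<close>\<close>

lemma inner_M_simps: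
  "inner_M M (x + y) w = inner_M M x w + inner_M M y w"
  "inner_M M w (x + y) = inner_M M w x + inner_M M w y"
  "inner_M M (x - y) w = inner_M M x w - inner_M M y w"
  "inner_M M w (x - y) = inner_M M w x - inner_M M w y"
  "inner_M M (c *\<^sub>R x) w = c * inner_M M x w"
  "inner_M M w (c *\<^sub>R x) = c * inner_M M w x"
  "inner_M M (- x) w = - inner_M M x w"
  "inner_M M w (- x) = - inner_M M w x"
  "inner_M M 0 w = 0"
  "inner_M M w 0 = 0"
  using matrix_vector_mult_scaleR[of M "-1" x]
  by (simp_all add: inner_M_def inner_simps matrix_vector_mult_scaleR matrix_vector_right_distrib
      matrix_vector_mult_diff_distrib)

text \<open>Turns the form into a standard inner product with a fixed vector \<open>M *v x\<close>,
  which commutes with integration.\<close>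

lemma inner_M_left:
  assumes "spd M"
  shows "inner_M M x y = (M *v x) \<bullet> y"
  using assms dot_lmul_matrix[of x M y] by (metis inner_M_def spd_def transpose_matrix_vector)

lemma inner_M_commute:
  assumes "spd M"
  shows "inner_M M x y = inner_M M y x"
  using inner_M_left[OF assms, of x y] by (simp add: inner_M_def inner_commute)

lemma sqnorm_M_nonneg:
  assumes "spd M"
  shows "0 \<le> sqnorm_M M x"
  using assms by (cases "x = 0") (auto simp: spd_def sqnorm_M_def inner_M_def less_imp_le)

lemma sqnorm_M_uminus: "sqnorm_M M (- x) = sqnorm_M M x"
  by (simp add: sqnorm_M_def inner_M_simps)

lemma sqnorm_M_diff:
  assumes "spd M"
  shows "sqnorm_M M (x - y) = sqnorm_M M x - 2 * inner_M M y x + sqnorm_M M y"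
  using inner_M_commute[OF assms, of x y] by (simp add: sqnorm_M_def inner_M_simps)

lemma borel_measurable_sqnorm_M [measurable]: "sqnorm_M M \<in> borel_measurable borel"
  unfolding sqnorm_M_def inner_M_def
  by (intro borel_measurable_continuous_onI continuous_intros
      linear_continuous_on_compose[OF continuous_on_id] matrix_vector_mul_linear)

section \<open>The atoms of \<open>Y\<close> and their masses\<close>

locale finite_split = split N X M u + prob_space N
  for N :: "'a measure" and X :: "'a \<Rightarrow> real^'d" and M :: "real^'d^'d" and u :: "real^'d" +
  assumes finitely_supported: "finitely_supported N X"
    and spd: "spd M"
begin

lemma X_measurable [measurable]: "X \<in> borel_measurable N"
  using finitely_supported by (simp add: finitely_supported_def)

lemma Y_measurable [measurable]: "Y \<in> borel_measurable N"
  unfolding Y_def[abs_def] by measurable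

text \<open>On finitely many values \<open>g\<close> is bounded, and bounded measurable functions
  are integrable over a probability space.\<close>

lemma integrable_comp_X:
  fixes g :: "real^'d \<Rightarrow> 'b::{second_countable_topology, banach}"
  assumes [measurable]: "g \<in> borel_measurable borel"
  shows "integrable N (\<lambda>\<omega>. g (X \<omega>))"
proof -
  obtain S where S: "finite S" "AE \<omega> in N. X \<omega> \<in> S"
    using finitely_supported by (auto simp: finitely_supported_def)
  then have "bounded (g ` S)" by (intro finite_imp_bounded) simp
  then obtain B where "\<And>x. x \<in> S \<Longrightarrow> norm (g x) \<le> B" by (auto simp: bounded_iff)
  then have "AE \<omega> in N. norm (g (X \<omega>)) \<le> B" using S(2) by (auto elim!: AE_mp)
  then show ?thesis by (intro integrable_const_bound) measurable
qed

text \<open>The image \<open>Z\<close> of the finite support contains almost all values of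
  \<open>Y\<close>. Values outside \<open>Z\<close> have mass zero, and removing the finitely many
  null values inside \<open>Z\<close> costs only a null set.\<close>

lemma finite_vals: "finite vals" and AE_Y_vals: "AE \<omega> in N. Y \<omega> \<in> vals"
proof -
  obtain S where S: "finite S" "AE \<omega> in N. X \<omega> \<in> S"
    using finitely_supported by (auto simp: finitely_supported_def)
  define Z where "Z = (\<lambda>x. u \<bullet> (x - mu)) ` S"
  have Z: "finite Z" "AE \<omega> in N. Y \<omega> \<in> Z"
    using S by (auto simp: Z_def Y_def elim!: AE_mp)
  have "measure N {\<omega> \<in> space N. Y \<omega> = s} = 0" if "s \<notin> Z" for s
  proof -
    have "AE \<omega> in N. \<not> Y \<omega> = s" using Z(2) that by (auto elim!: AE_mp)
    then show ?thesis by (subst prob_eq_0) auto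
  qed
  then have "vals \<subseteq> Z" by (force simp: vals_def)
  then show "finite vals" using Z(1) finite_subset by blast
  have "AE \<omega> in N. \<forall>s\<in>Z - vals. Y \<omega> \<noteq> s"
  proof (rule AE_finite_allI)
    fix s assume "s \<in> Z - vals"
    then have "measure N {\<omega> \<in> space N. Y \<omega> = s} = 0"
      by (simp add: vals_def) (metis measure_nonneg order_le_less)
    then show "AE \<omega> in N. Y \<omega> \<noteq> s" by (subst (asm) prob_eq_0) auto
  qed (use Z in simp)
  then show "AE \<omega> in N. Y \<omega> \<in> vals" using Z(2) by eventually_elim auto
qed

lemma m_pos: "1 \<le> m"
proof -
  have "vals \<noteq> {}" using AE_Y_vals by auto
  then show ?thesis using finite_vals by (simp add: m_def Suc_le_eq card_gt_0_iff)
qed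

lemma t_in_vals: "i \<in> {1..m} \<Longrightarrow> t i \<in> vals"
  using nth_mem[of "i - 1" "sorted_list_of_set vals"] finite_vals by (auto simp: t_def m_def)

lemma t_less: "1 \<le> i \<Longrightarrow> i < j \<Longrightarrow> j \<le> m \<Longrightarrow> t i < t j"
  using sorted_wrt_nth_less[OF strict_sorted_list_of_set, of "i - 1" "j - 1" vals]
  by (auto simp: t_def m_def)

lemma t_le_iff: "i \<in> {1..m} \<Longrightarrow> j \<in> {1..m} \<Longrightarrow> t i \<le> t j \<longleftrightarrow> i \<le> j"
  using t_less[of i j] t_less[of j i] by (cases i j rule: linorder_cases) auto

lemma t_eq_iff: "i \<in> {1..m} \<Longrightarrow> j \<in> {1..m} \<Longrightarrow> t i = t j \<longleftrightarrow> i = j"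
  using t_le_iff[of i j] t_le_iff[of j i] by auto

lemma vals_eq: "vals = t ` {1..m}"
proof
  show "vals \<subseteq> t ` {1..m}"
  proof
    fix s assume "s \<in> vals"
    then obtain k where "k < m" "s = sorted_list_of_set vals ! k"
      using finite_vals by (metis in_set_conv_nth m_def length_sorted_list_of_set set_sorted_list_of_set)
    then show "s \<in> t ` {1..m}" by (auto simp: t_def intro!: image_eqI[of _ _ "Suc k"])
  qed
qed (use t_in_vals in auto)

lemma p_pos: "i \<in> {1..m} \<Longrightarrow> 0 < p i"
  using t_in_vals[of i] by (simp add: vals_def p_def)

lemma P_Suc: "P (Suc k) = P k + p (Suc k)"
  by (simp add: P_def)

lemma P_0 [simp]: "P 0 = 0"
  by (simp add: P_def)

section \<open>Mass and first moment of the left groups\<close>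

lemma integrable_slice:
  fixes g :: "real^'d \<Rightarrow> 'b::{second_countable_topology, banach}"
  assumes "g \<in> borel_measurable borel" "A \<in> sets borel"
  shows "integrable N (\<lambda>\<omega>. indicator {\<omega>. Y \<omega> \<in> A} \<omega> *\<^sub>R g (X \<omega>))"
proof -
  have "integrable N (\<lambda>\<omega>. (\<lambda>x. (indicator A (u \<bullet> (x - mu)) :: real) *\<^sub>R g x) (X \<omega>))"
    using assms by (intro integrable_comp_X borel_measurable_scaleR
        measurable_compose[OF _ borel_measurable_indicator]) auto
  then show ?thesis by (simp add: Y_def indicator_def)
qed

text \<open>Links the risk, defined through \<open>Y \<omega> \<le> t i\<close>, to the atoms.
  Almost surely \<open>Y\<close> equals some \<open>t k\<close>, and the sum of indicators is then 1
  exactly when \<open>k \<le> i\<close>. A general \<open>g\<close> covers both masses and vector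
  moments.\<close>

lemma integral_le_eq_sum:
  fixes g :: "real^'d \<Rightarrow> 'b::{second_countable_topology, banach}"
  assumes g: "g \<in> borel_measurable borel" and i: "i \<in> {1..m}"
  shows "(\<integral>\<omega>. indicator {\<omega>. Y \<omega> \<le> t i} \<omega> *\<^sub>R g (X \<omega>) \<partial>N)
    = (\<Sum>j=1..i. \<integral>\<omega>. indicator {\<omega>. Y \<omega> = t j} \<omega> *\<^sub>R g (X \<omega>) \<partial>N)"
proof -
  have int: "integrable N (\<lambda>\<omega>. indicator {\<omega>. Y \<omega> = t j} \<omega> *\<^sub>R g (X \<omega>))" for j
    using integrable_slice[OF g, of "{t j}"] by simp
  have int_le: "integrable N (\<lambda>\<omega>. indicator {\<omega>. Y \<omega> \<le> t i} \<omega> *\<^sub>R g (X \<omega>))"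
    using integrable_slice[OF g, of "{..t i}"] by simp
  have "AE \<omega> in N. indicator {\<omega>. Y \<omega> \<le> t i} \<omega> *\<^sub>R g (X \<omega>)
      = (\<Sum>j=1..i. indicator {\<omega>. Y \<omega> = t j} \<omega> *\<^sub>R g (X \<omega>))"
    using AE_Y_vals
  proof eventually_elim
    case (elim \<omega>)
    then obtain k where k: "k \<in> {1..m}" "Y \<omega> = t k" by (auto simp: vals_eq)
    have "(\<Sum>j=1..i. indicator {\<omega>. Y \<omega> = t j} \<omega> :: real) = (\<Sum>j=1..i. if j = k then 1 else 0)"
      using k i t_eq_iff by (intro sum.cong) (auto simp: indicator_def)
    also have "\<dots> = indicator {\<omega>. Y \<omega> \<le> t i} \<omega>"
      using k i t_le_iff by (auto simp: indicator_def)
    finally show ?case by (simp add: scaleR_sum_left[symmetric])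
  qed
  then have "(\<integral>\<omega>. indicator {\<omega>. Y \<omega> \<le> t i} \<omega> *\<^sub>R g (X \<omega>) \<partial>N)
      = (\<integral>\<omega>. (\<Sum>j=1..i. indicator {\<omega>. Y \<omega> = t j} \<omega> *\<^sub>R g (X \<omega>)) \<partial>N)"
    using int int_le
    by (intro integral_cong_AE borel_measurable_sum borel_measurable_integrable) blast+
  also have "\<dots> = (\<Sum>j=1..i. \<integral>\<omega>. indicator {\<omega>. Y \<omega> = t j} \<omega> *\<^sub>R g (X \<omega>) \<partial>N)"
    using int by (intro Bochner_Integration.integral_sum)
  finally show ?thesis .
qed

text \<open>The unnormalised first moment of the centred vector over the left group. Both group
  means are multiples of it, and it is meaningful for empty groups too.\<close>

definition S :: "nat \<Rightarrow> real^'d" where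
  "S i = (\<Sum>j=1..i. p j *\<^sub>R z j)"

lemma S_Suc: "S (Suc k) = S k + p (Suc k) *\<^sub>R z (Suc k)"
  by (simp add: S_def)

lemma S_0 [simp]: "S 0 = 0"
  by (simp add: S_def)

lemma integral_P:
  assumes "i \<in> {1..m}"
  shows "(\<integral>\<omega>. indicator {\<omega>. Y \<omega> \<le> t i} \<omega> \<partial>N) = P i"
proof -
  have "(\<integral>\<omega>. indicator {\<omega>. Y \<omega> = s} \<omega> \<partial>N) = measure N {\<omega> \<in> space N. Y \<omega> = s}" for s
    by (subst Bochner_Integration.integral_indicator)
      (auto intro!: arg_cong[where f="measure N"])
  then show ?thesis
    using integral_le_eq_sum[of "\<lambda>_. 1::real", OF _ assms] by (simp add: P_def p_def)
qed

lemma integral_S: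
  assumes "i \<in> {1..m}"
  shows "(\<integral>\<omega>. indicator {\<omega>. Y \<omega> \<le> t i} \<omega> *\<^sub>R (X \<omega> - mu) \<partial>N) = S i"
proof -
  have "(\<integral>\<omega>. indicator {\<omega>. Y \<omega> = t j} \<omega> *\<^sub>R (X \<omega> - mu) \<partial>N) = p j *\<^sub>R z j" if "j \<in> {1..m}" for j
    using p_pos[OF that] by (simp add: z_def)
  then show ?thesis
    using integral_le_eq_sum[of "\<lambda>x. x - mu", OF _ assms] assms by (simp add: S_def)
qed

lemma AE_Y_le: "AE \<omega> in N. Y \<omega> \<le> t m"
  using AE_Y_vals
proof eventually_elim
  case (elim \<omega>)
  then obtain k where "k \<in> {1..m}" "Y \<omega> = t k" by (auto simp: vals_eq)
  then show ?case using t_le_iff[of k m] by simp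
qed

lemma P_m: "P m = 1"
proof -
  have "P m = (\<integral>\<omega>. indicator {\<omega>. Y \<omega> \<le> t m} \<omega> \<partial>N)" using integral_P[of m] m_pos by simp
  also have "\<dots> = (\<integral>\<omega>. 1 \<partial>N)" using AE_Y_le by (intro integral_cong_AE) auto
  finally show ?thesis by (simp add: prob_space)
qed

text \<open>The last left group is almost the whole space, and the centred vector has mean
  zero.\<close>

lemma S_m: "S m = 0"
proof -
  have "S m = (\<integral>\<omega>. indicator {\<omega>. Y \<omega> \<le> t m} \<omega> *\<^sub>R (X \<omega> - mu) \<partial>N)"
    using integral_S[of m] m_pos by simp
  also have "\<dots> = (\<integral>\<omega>. X \<omega> - mu \<partial>N)" using AE_Y_le by (intro integral_cong_AE) auto
  also have "\<dots> = 0"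
    using integrable_comp_X[of "\<lambda>x. x"] by (simp add: mu_def prob_space)
  finally show ?thesis .
qed

lemma q_m [simp]: "q m = 0"
  by (simp add: q_def P_m)

lemma P_step: "i \<in> {1..m} \<Longrightarrow> P (i - 1) < P i"
  using P_Suc[of "i - 1"] p_pos[of i] by simp

lemma P_pos: "i \<in> {1..m} \<Longrightarrow> 0 < P i"
  using strict_steps_mono[of m P 0 "i - 1"] P_step P_step[of i]
  by (simp add: order_le_less_trans[of 0 "P (i - 1)"] le_diff_conv)

lemma q_pos: "i < m \<Longrightarrow> 0 < q i"
  using strict_steps_mono[of m P "Suc i" m] P_step P_step[of "Suc i"] P_m by (simp add: q_def)

lemma a_eq: "a i = (1 / P i) *\<^sub>R S i"
  by (simp add: a_def S_def)

text \<open>The left and right sums add up to \<open>S m = 0\<close>, so the right sum is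
  \<open>- S i\<close>.\<close>

lemma b_eq:
  assumes "i \<le> m"
  shows "b i = (- 1 / q i) *\<^sub>R S i"
proof -
  have "S m = S i + (\<Sum>j=i+1..m. p j *\<^sub>R z j)"
    unfolding S_def using assms sum.ub_add_nat[of 1 i "\<lambda>j. p j *\<^sub>R z j" "m - i"] by simp
  then have "(\<Sum>j=i+1..m. p j *\<^sub>R z j) = - S i" by (simp add: S_m eq_neg_iff_add_eq_0 add.commute)
  then show ?thesis by (simp add: b_def)
qed

section \<open>The least risk of a two-group partition\<close>

definition T :: real where
  "T = (\<integral>\<omega>. sqnorm_M M (X \<omega> - mu) \<partial>N)"

text \<open>With centres measured from \<open>mu\<close>, expanding the squares leaves only the
  moments \<open>T\<close>, \<open>P i\<close> and \<open>S i\<close>.\<close>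

lemma risk_eq:
  assumes i: "i \<in> {1..m}"
  shows "risk i (mu + \<alpha>) (mu + \<beta>) = T - 2 * inner_M M \<alpha> (S i) + P i * sqnorm_M M \<alpha>
      + 2 * inner_M M \<beta> (S i) + q i * sqnorm_M M \<beta>"
proof -
  let ?I = "\<lambda>\<omega>. indicator {\<omega>. Y \<omega> \<le> t i} \<omega> :: real"
  let ?c = "2 *\<^sub>R (\<beta> - \<alpha>)" and ?d = "sqnorm_M M \<alpha> - sqnorm_M M \<beta>"
  \<comment> \<open>The right indicator is replaced by 1 minus the left one, so that only moments of
    the left group need evaluating.\<close>
  have pointwise: "sqnorm_M M (X \<omega> - (mu + \<alpha>)) * ?I \<omega>
        + sqnorm_M M (X \<omega> - (mu + \<beta>)) * indicator {\<omega>. Y \<omega> > t i} \<omega>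
      = sqnorm_M M (X \<omega> - mu) + (M *v ?c) \<bullet> (?I \<omega> *\<^sub>R (X \<omega> - mu)) + ?d * ?I \<omega>
        - (2 * ((M *v \<beta>) \<bullet> (X \<omega> - mu)) - sqnorm_M M \<beta>)" for \<omega>
    unfolding diff_diff_eq[symmetric] sqnorm_M_diff[OF spd, of "X \<omega> - mu"] inner_M_left[OF spd, symmetric]
    by (cases "Y \<omega> \<le> t i") (auto simp: inner_M_simps algebra_simps)
  have int: "integrable N (\<lambda>\<omega>. sqnorm_M M (X \<omega> - mu))" "integrable N (\<lambda>\<omega>. X \<omega> - mu)"
    by (rule integrable_comp_X, measurable)+
  have int_I: "integrable N ?I" "integrable N (\<lambda>\<omega>. ?I \<omega> *\<^sub>R (X \<omega> - mu))"
    using integrable_slice[of "\<lambda>_. 1::real" "{..t i}"] integrable_slice[of "\<lambda>x. x - mu" "{..t i}"]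
    by simp_all
  have "(\<integral>\<omega>. X \<omega> - mu \<partial>N) = 0"
    using integrable_comp_X[of "\<lambda>x. x"] by (simp add: mu_def prob_space)
  then have "risk i (mu + \<alpha>) (mu + \<beta>) = T + (M *v ?c) \<bullet> S i + ?d * P i + sqnorm_M M \<beta>"
    unfolding risk_def pointwise using int int_I
    by (simp add: T_def integral_S[OF i] integral_P[OF i] prob_space del: inner_scaleR_right
        Bochner_Integration.integral_indicator)
  then show ?thesis
    by (simp add: inner_M_left[OF spd, symmetric] inner_M_simps q_def algebra_simps)
qed

text \<open>Division by zero makes this formula valid for \<open>i = 0\<close> and \<open>i = m\<close> too, since there \<open>S i = 0\<close>.\<close>

lemma V_eq:
  assumes "i \<le> m"
  shows "V i = T - sqnorm_M M (S i) / P i - sqnorm_M M (S i) / q i"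
proof (cases "i = 0 \<or> i = m")
  case True
  then show ?thesis by (auto simp: V_def T_def S_m sqnorm_M_def inner_M_simps)
next
  case False
  then have i: "i \<in> {1..m}" and pos: "0 < P i" "0 < q i"
    using assms P_pos q_pos by auto
  let ?v = "T - sqnorm_M M (S i) / P i - sqnorm_M M (S i) / q i"
  \<comment> \<open>Completing the square for a group of weight \<open>r\<close> and sum
    \<open>s\<close>; used with \<open>P i\<close>, \<open>S i\<close> and with \<open>q i\<close>,
    \<open>- S i\<close>.\<close>
  have square: "r * sqnorm_M M (x - (1 / r) *\<^sub>R s)
      = r * sqnorm_M M x - 2 * inner_M M x s + sqnorm_M M s / r" if "0 < r" for r x s
    using that unfolding sqnorm_M_diff[OF spd] inner_M_commute[OF spd, of _ x]
    by (simp add: sqnorm_M_def inner_M_simps field_simps power2_eq_square)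
  have risk: "risk i \<alpha> \<beta> = ?v + P i * sqnorm_M M (\<alpha> - mu - (1 / P i) *\<^sub>R S i)
      + q i * sqnorm_M M (\<beta> - mu - (1 / q i) *\<^sub>R (- S i))" for \<alpha> \<beta>
    unfolding square[OF pos(1)] square[OF pos(2)]
    using risk_eq[OF i, of "\<alpha> - mu" "\<beta> - mu"]
    by (simp add: inner_M_simps sqnorm_M_def)
  have "(LEAST v. \<exists>\<alpha> \<beta>. v = risk i \<alpha> \<beta>) = ?v"
  proof (rule Least_equality)
    \<comment> \<open>The minimum is attained at the conditional means \<open>mu + a i\<close> and
      \<open>mu + b i\<close>.\<close>
    have "?v = risk i (mu + (1 / P i) *\<^sub>R S i) (mu + (1 / q i) *\<^sub>R (- S i))"
      unfolding risk by (simp add: sqnorm_M_def inner_M_simps)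
    then show "\<exists>\<alpha> \<beta>. ?v = risk i \<alpha> \<beta>" by blast
    show "?v \<le> v" if "\<exists>\<alpha> \<beta>. v = risk i \<alpha> \<beta>" for v
      using that sqnorm_M_nonneg[OF spd] pos by (auto simp: risk add_nonneg_nonneg)
  qed
  then show ?thesis using False by (simp add: V_def)
qed

section \<open>The vector radii as increments, and the slopes of the polygon\<close>

text \<open>An atom \<open>w\<close> of weight \<open>c\<close> joins a group of weight
  \<open>r\<close> and sum \<open>s\<close>. The two factors are the deviations of \<open>w\<close>
  from the old and the new group mean, and the right side is the resulting growth of the
  within-group variance. Both radii are instances.\<close>

lemma inner_M_mean_step:
  assumes "0 < r" "0 < c"
  shows "c * inner_M M (w - (1 / r) *\<^sub>R s) (w - (1 / (r + c)) *\<^sub>R (s + c *\<^sub>R w))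
    = sqnorm_M M s / r + c * sqnorm_M M w - sqnorm_M M (s + c *\<^sub>R w) / (r + c)"
proof -
  \<comment> \<open>A scalar identity in the products of \<open>s\<close> with itself
    (\<open>A\<close>), \<open>w\<close> with \<open>s\<close> (\<open>B\<close>) and
    \<open>w\<close> with itself (\<open>C\<close>). The instantiation below follows the order of
    occurrence: \<open>C\<close>, \<open>B\<close>, \<open>A\<close>.\<close>
  have "c * (C - (B + c * C) / (r + c) - (B / r - (A + c * B) / (r * (r + c))))
      = A / r + c * C - (A + 2 * c * B + c * c * C) / (r + c)" for A B C :: real
    using assms by (simp add: divide_simps) (simp add: algebra_simps)
  from this[of "inner_M M w w" "inner_M M w s" "inner_M M s s"] show ?thesis
    using inner_M_commute[OF spd, of s w]
    by (simp add: sqnorm_M_def inner_M_simps add_divide_distrib algebra_simps)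
qed

lemma p_L_sq:
  assumes i: "i \<in> {1..m}"
  shows "p i * L_sq i
    = sqnorm_M M (S (i - 1)) / P (i - 1) + p i * sqnorm_M M (z i) - sqnorm_M M (S i) / P i"
proof -
  obtain k where k: "i = Suc k" using i by (cases i) auto
  show ?thesis
  proof (cases "k = 0")
    \<comment> \<open>For the first atom the left group was empty: the term over
      \<open>P 0 = 0\<close> is zero and the other two cancel, matching the convention for
      \<open>L_sq 1\<close>.\<close>
    case True
    then show ?thesis
      using p_pos[OF i] by (simp add: k L_sq_def S_Suc P_Suc sqnorm_M_def inner_M_simps)
  next
    case False
    then show ?thesis
      using inner_M_mean_step[of "P k" "p i" "z i" "S k"] P_pos[of k] p_pos[OF i] i
      by (simp add: k L_sq_def a_eq P_Suc S_Suc)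
  qed
qed

text \<open>The step is read backwards, from \<open>i\<close> to \<open>i - 1\<close>: the atom
  \<open>z i\<close> joins the right group of weight \<open>q i\<close> and sum
  \<open>- S i\<close>.\<close>

lemma p_R_sq:
  assumes i: "i \<in> {1..m}"
  shows "p i * R_sq i
    = sqnorm_M M (S i) / q i + p i * sqnorm_M M (z i) - sqnorm_M M (S (i - 1)) / q (i - 1)"
proof -
  define k where "k = i - 1"
  then have "i = Suc k" using i by simp
  then have qk: "q k = q i + p i" and Sk: "S k = S i - p i *\<^sub>R z i"
    by (simp_all add: q_def P_Suc S_Suc)
  have "p i * R_sq i = sqnorm_M M (S i) / q i + p i * sqnorm_M M (z i) - sqnorm_M M (S k) / q k"
  proof (cases "i = m")
    \<comment> \<open>The right group is empty before the last atom joins it, so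
      \<open>q k = p i\<close> and \<open>S k\<close> is \<open>- p i *\<^sub>R z i\<close>; the two
      remaining terms cancel.\<close>
    case True
    then have "R_sq i = 0" "S i = 0" "q i = 0" by (simp_all add: R_sq_def S_m)
    then show ?thesis
      using p_pos[OF i] by (simp add: qk Sk sqnorm_M_def inner_M_simps)
  next
    case False
    have "R_sq i = inner_M M (b k - z i) (b i - z i)" using False by (simp add: R_sq_def k_def)
    \<comment> \<open>Symmetry and two sign changes put the mean before joining, \<open>b i\<close>,
      in the first factor.\<close>
    also have "\<dots> = inner_M M (z i - b i) (z i - b k)"
      using inner_M_commute[OF spd, of "b k - z i"] by (simp add: inner_M_simps)
    also have "b i = (1 / q i) *\<^sub>R (- S i)" using i by (simp add: b_eq)
    also have "b k = (1 / (q i + p i)) *\<^sub>R (- S i + p i *\<^sub>R z i)"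
      using i b_eq[of k] \<open>i = Suc k\<close> by (simp add: qk Sk scaleR_right_diff_distrib)
    finally have "p i * R_sq i = sqnorm_M M (- S i) / q i + p i * sqnorm_M M (z i)
        - sqnorm_M M (- S i + p i *\<^sub>R z i) / (q i + p i)"
      using inner_M_mean_step[of "q i" "p i" "z i" "- S i"] q_pos[of i] p_pos[OF i] i False by simp
    moreover have "sqnorm_M M (- S i + p i *\<^sub>R z i) = sqnorm_M M (S k)"
      using sqnorm_M_uminus[of M "S k"] by (simp add: Sk)
    ultimately show ?thesis by (simp add: qk sqnorm_M_uminus)
  qed
  then show ?thesis by (simp add: k_def)
qed

text \<open>On subtracting \<open>p_R_sq\<close> from \<open>p_L_sq\<close> the terms in
  \<open>z i\<close> cancel, and what remains is the increment of \<open>V_eq\<close>.\<close>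

lemma V_step:
  assumes "i \<in> {1..m}"
  shows "V i - V (i - 1) = p i * (L_sq i - R_sq i)"
  using assms p_L_sq[OF assms] p_R_sq[OF assms]
  by (auto simp: V_eq right_diff_distrib)

lemma convex_polygon_iff_H: "convex_polygon P V m \<longleftrightarrow> antimono_on {1..m} H"
proof -
  have "convex_polygon P V m \<longleftrightarrow> mono_on {1..m} (\<lambda>i. - H i)"
  proof (rule convex_polygon_iff)
    show "V i - V (i - 1) = - H i * (P i - P (i - 1))" if "i \<in> {1..m}" for i
      using V_step[OF that] P_Suc[of "i - 1"] that by (simp add: H_def algebra_simps)
  qed (use m_pos P_step in auto)
  then show ?thesis by (simp add: monotone_on_def)
qed

end

section \<open>Monotone radii are not necessary for convexity\<close>

text \<open>On a line, take the atoms -17, -7, 3 with masses 1/10, 1/10, 8/10. The second value of \<open>L_sq\<close>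
  is 50 and the third is 45, while the large value of \<open>R_sq\<close> at the first atom keeps \<open>H\<close> decreasing.\<close>

lemma exists_convex_polygon_without_monotone_radii:
  "\<exists>(N :: (real^'d) measure) (X :: real^'d \<Rightarrow> real^'d) (M :: real^'d^'d) (u :: real^'d).
    prob_space N \<and> finitely_supported N X \<and> spd M \<and> u \<noteq> 0
    \<and> convex_polygon (split.P N X u) (split.V N X M u) (split.m N X u)
    \<and> \<not> (mono_on {1..split.m N X u} (split.L_sq N X M u)
         \<and> antimono_on {1..split.m N X u} (split.R_sq N X M u))"
proof -
  \<comment> \<open>A unit vector along an arbitrary coordinate carries the example on the line into
    any dimension.\<close>
  define e :: "real^'d" where "e = axis undefined 1"
  have e: "e \<bullet> e = 1" by (simp add: e_def inner_axis_axis)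
  \<comment> \<open>Ten equally likely indices: one is sent to each of the first two atoms and eight
    to the third.\<close>
  define v where "v n = (if n = 0 then -17 else if n = 1 then -7 else 3 :: real) *\<^sub>R e" for n :: nat
  define N where "N = measure_pmf (map_pmf v (pmf_of_set {..<10}))"
  define X where "X = (\<lambda>x :: real^'d. x)"
  have X: "X x = x" for x by (simp add: X_def)
  have nonempty: "{..<10::nat} \<noteq> {}" by (simp add: lessThan_empty_iff)
  have range_split: "{..<10::nat} = insert 0 (insert 1 {2..<10})" by auto
  have integral_N: "(\<integral>x. g x \<partial>N) = (1/10) *\<^sub>R g ((-17) *\<^sub>R e) + (1/10) *\<^sub>R g ((-7) *\<^sub>R e)
      + (8/10) *\<^sub>R g (3 *\<^sub>R e)" for g :: "real^'d \<Rightarrow> 'b::{second_countable_topology, banach}"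
  proof -
    have "(\<integral>x. g x \<partial>N) = (\<Sum>n<10. pmf (pmf_of_set {..<10}) n *\<^sub>R g (v n))"
      unfolding N_def integral_map_pmf by (rule integral_measure_pmf) (simp_all add: nonempty)
    also have "\<dots> = (\<Sum>n<10. (1/10) *\<^sub>R g (v n))"
      by (intro sum.cong) (simp_all add: nonempty)
    also have "\<dots> = (1/10) *\<^sub>R g ((-17) *\<^sub>R e) + (1/10) *\<^sub>R g ((-7) *\<^sub>R e)
        + (\<Sum>n=2..<10. (1/10) *\<^sub>R g (v n))"
      unfolding range_split by (simp add: v_def)
    also have "(\<Sum>n=2..<10. (1/10) *\<^sub>R g (v n)) = (\<Sum>n=2..<10::nat. (1/10) *\<^sub>R g (3 *\<^sub>R e))"
      by (intro sum.cong) (auto simp: v_def)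
    finally show ?thesis by (simp add: sum_constant_scaleR)
  qed
  have spd_1: "spd (mat 1 :: real^'d^'d)" by (simp add: spd_def transpose_mat)
  have "prob_space N" unfolding N_def by (rule prob_space_measure_pmf)
  moreover have fin: "finitely_supported N X"
    unfolding finitely_supported_def
  proof (intro conjI exI)
    show "X \<in> borel_measurable N" by (simp add: N_def)
    show "AE \<omega> in N. X \<omega> \<in> v ` {..<10}"
      unfolding N_def X_def by (simp add: AE_measure_pmf_iff nonempty)
  qed simp
  ultimately interpret ex: finite_split N X "mat 1" e
    using spd_1 by (auto simp: finite_split_def finite_split_axioms_def)
  \<comment> \<open>The atoms are balanced: -17 - 7 + 8 * 3 = 0.\<close>
  have "ex.mu = 0" by (simp add: ex.mu_def integral_N X vec_eq_iff)
  then have Y: "ex.Y x = e \<bullet> x" for x by (simp add: ex.Y_def X)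
  have prob: "measure N {\<omega> \<in> space N. ex.Y \<omega> = s}
      = (if s = -17 then 1/10 else if s = -7 then 1/10 else if s = 3 then 8/10 else 0)" for s
  proof -
    have "measure N {\<omega> \<in> space N. ex.Y \<omega> = s} = (\<integral>x. indicator {\<omega>. ex.Y \<omega> = s} x \<partial>N)"
      by (simp add: N_def)
    then show ?thesis by (simp add: integral_N Y e indicator_def)
  qed
  note One_nat_def [simp del]
  have vals: "ex.vals = {-17, -7, 3}" by (auto simp: ex.vals_def prob split: if_splits)
  have m: "ex.m = 3" by (simp add: ex.m_def vals)
  have "sorted_list_of_set ex.vals = [-17, -7, 3]" by (simp add: vals)
  then have t: "ex.t 1 = -17" "ex.t 2 = -7" "ex.t 3 = 3" by (simp_all add: ex.t_def)
  have p: "ex.p 1 = 1/10" "ex.p 2 = 1/10" "ex.p 3 = 8/10" by (simp_all add: ex.p_def t prob)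
  have z: "ex.z 1 = (-17) *\<^sub>R e" "ex.z 2 = (-7) *\<^sub>R e" "ex.z 3 = 3 *\<^sub>R e"
    by (simp_all add: ex.z_def p t integral_N Y e \<open>ex.mu = 0\<close> X)
  have "sqnorm_M (mat 1) (c *\<^sub>R e) = c * c" for c by (simp add: sqnorm_M_def inner_M_def e)
  note sq = this sqnorm_M_uminus this[of 0, simplified]
  have P: "ex.P 1 = 1/10" "ex.P 2 = 2/10" "ex.P 3 = 1"
    using ex.P_Suc[of 0] ex.P_Suc[of 1] ex.P_Suc[of 2] p by (simp_all add: numeral_eq_Suc One_nat_def)
  have S_step: "ex.S 1 = ex.S 0 + ex.p 1 *\<^sub>R ex.z 1" "ex.S 2 = ex.S 1 + ex.p 2 *\<^sub>R ex.z 2"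
    "ex.S 3 = ex.S 2 + ex.p 3 *\<^sub>R ex.z 3"
    using ex.S_Suc[of 0] ex.S_Suc[of 1] ex.S_Suc[of 2] by (simp_all add: numeral_eq_Suc One_nat_def)
  have S: "ex.S 0 = 0 *\<^sub>R e" "ex.S 1 = (-17/10) *\<^sub>R e" "ex.S 2 = (-24/10) *\<^sub>R e" "ex.S 3 = 0 *\<^sub>R e"
    by (simp_all add: S_step p z vec_eq_iff)
  note P_S = P S P(1)[unfolded One_nat_def] S(2)[unfolded One_nat_def]
  \<comment> \<open>Products of deviations from consecutive left means -17, -12, 0: 10 * 5 = 50 and
    15 * 3 = 45. They are obtained here through the increment formula.\<close>
  have L: "ex.L_sq 1 = 0" "ex.L_sq 2 = 50" "ex.L_sq 3 = 45"
    using ex.p_L_sq[of 2] ex.p_L_sq[of 3] by (simp_all add: ex.L_sq_def[of 1] m p P_S z sq)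
  have R: "ex.R_sq 1 = 2890/9" "ex.R_sq 2 = 800/9" "ex.R_sq 3 = 0"
    using ex.p_R_sq[of 1] ex.p_R_sq[of 2]
    by (simp_all add: ex.R_sq_def[of 3] m p P_S z sq ex.q_def)
  have "antimono_on {1..ex.m} ex.H"
  proof -
    have "ex.H j \<le> ex.H i" if "i \<in> {1, 2, 3}" "j \<in> {1, 2, 3}" "i \<le> j" for i j
      using that by (auto simp: ex.H_def L R)
    moreover have "{1..ex.m} = {1, 2, 3}" by (auto simp: m)
    ultimately show ?thesis by (simp only: monotone_on_def) blast
  qed
  moreover have "\<not> mono_on {1..ex.m} ex.L_sq"
    using mono_onD[of "{1..ex.m}" ex.L_sq 2 3] by (auto simp: m L)
  moreover have "e \<noteq> 0" using e by auto
  ultimately show ?thesis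
    using ex.prob_space_axioms fin spd_1 ex.convex_polygon_iff_H by blast
qed

text \<open>The last conjunct expresses that the sufficient condition is strictly stronger than
  convexity, by an example in the same dimension as the given vector.\<close>

theorem proposition6p2:
  fixes N :: "'a measure" and X :: "'a \<Rightarrow> real^'d" and M :: "real^'d^'d" and u :: "real^'d"
  assumes "prob_space N"
    and "finitely_supported N X"
    and "spd M"
    and "u \<noteq> 0"
  shows
    "(\<forall>i\<in>{1..split.m N X u}.
        split.V N X M u i - split.V N X M u (i - 1)
          = split.p N X u i * (split.L_sq N X M u i - split.R_sq N X M u i)
      \<and> split.p N X u i * (split.L_sq N X M u i - split.R_sq N X M u i)
          = - split.p N X u i * split.H N X M u i)
   \<and> (convex_polygon (split.P N X u) (split.V N X M u) (split.m N X u)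
        \<longleftrightarrow> antimono_on {1..split.m N X u} (split.H N X M u))
   \<and> (mono_on {1..split.m N X u} (split.L_sq N X M u)
        \<and> antimono_on {1..split.m N X u} (split.R_sq N X M u)
        \<longrightarrow> convex_polygon (split.P N X u) (split.V N X M u) (split.m N X u))
   \<and> (\<exists>(N' :: (real^'d) measure) (X' :: real^'d \<Rightarrow> real^'d) (M' :: real^'d^'d) (u' :: real^'d).
        prob_space N' \<and> finitely_supported N' X' \<and> spd M' \<and> u' \<noteq> 0
        \<and> convex_polygon (split.P N' X' u') (split.V N' X' M' u') (split.m N' X' u')
        \<and> \<not> (mono_on {1..split.m N' X' u'} (split.L_sq N' X' M' u')
             \<and> antimono_on {1..split.m N' X' u'} (split.R_sq N' X' M' u')))"
proof -
  interpret finite_split N X M u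
    using assms by (simp add: finite_split_def finite_split_axioms_def)
  \<comment> \<open>Subtracting a nondecreasing sequence from a nonincreasing one keeps it
    nonincreasing.\<close>
  have "antimono_on {1..m} H" if "mono_on {1..m} L_sq" "antimono_on {1..m} R_sq"
    using that unfolding monotone_on_def H_def by (blast intro: diff_mono)
  then show ?thesis
    using V_step convex_polygon_iff_H exists_convex_polygon_without_monotone_radii
    by (auto simp: H_def algebra_simps)
qed

end
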